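(* Let $f:[a,b]\to\mathbb R$ be a continuous function with $f(a)=f(b)$. Then there exist $\alpha,\beta\in\mathbb R^+$ and $c\in\,]a,b[$ such that $D_{\alpha,\beta}[f](c)=0$.
   Context: For $f:[a,b]\to\mathbb R$ and $\alpha,\beta>0$ with $b-a>\max\{\alpha,\beta\}$, the $\alpha,\beta$-symmetric difference derivative is $D_{\alpha,\beta}[f](t)=\frac{f(t+\alpha)-f(t-\beta)}{\alpha+\beta}$, defined for $t\in[a,b]\setminus([a,a+\beta]\cup[b-\alpha,b])$. The equation $D_{\alpha,\beta}[f](c)=0$ includes the assertion that $c$ lies in this domain. $\mathbb R^+$ denotes the positive reals and $a<b$. *)

theory Defs
  imports "HOL-Analysis.Analysis"
begin

text \<open>
  A function \<open>f : [a,b] \<rightarrow> \<real>\<close> is represented by a total function on the reals of which only the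
  values on \<open>{a..b}\<close> matter. The quotient \<open>sym_diff_deriv\<close> is a total expression, so its domain
  of definition is a separate set: for \<open>t \<in> sym_diff_dom a b \<alpha> \<beta>\<close> with \<open>\<alpha>, \<beta> > 0\<close>, both
  \<open>t + \<alpha>\<close> and \<open>t - \<beta>\<close> lie in \<open>{a..b}\<close>.
\<close>

definition sym_diff_deriv :: "real \<Rightarrow> real \<Rightarrow> (real \<Rightarrow> real) \<Rightarrow> real \<Rightarrow> real" where
  "sym_diff_deriv \<alpha> \<beta> f t = (f (t + \<alpha>) - f (t - \<beta>)) / (\<alpha> + \<beta>)"

definition sym_diff_dom :: "real \<Rightarrow> real \<Rightarrow> real \<Rightarrow> real \<Rightarrow> real set" where
  "sym_diff_dom a b \<alpha> \<beta> = {a..b} - ({a..a + \<beta>} \<union> {b - \<alpha>..b})"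

end

theory Submission imports Defs begin

text \<open>
  As in Rolle's theorem, \<open>f\<close> attains an extremum at an interior point \<open>x\<close>. Compare the values of
  \<open>f\<close> at one interior point on each side of \<open>x\<close>: the value closer to \<open>f x\<close> is taken on both
  sides, by the intermediate value theorem. This gives \<open>a < p < q < b\<close> with \<open>f p = f q\<close>, and the
  midpoint of \<open>p\<close> and \<open>q\<close> is the required point.
\<close>

lemma interior_max_imp_equal_values:
  fixes f :: "real \<Rightarrow> real"
  assumes cont: "continuous_on {a..b} f" and x: "a < x" "x < b"
    and max: "\<And>y. y \<in> {a..b} \<Longrightarrow> f y \<le> f x"
  obtains p q where "a < p" "p < q" "q < b" "f p = f q"
proof -
  obtain u where u: "a < u" "u < x" using dense x by blast
  obtain v where v: "x < v" "v < b" using dense x by blast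
  have le: "f u \<le> f x" "f v \<le> f x" using max u v x by auto
  show thesis
  proof (cases "f v \<le> f u")
    case True
    \<comment> \<open>Here \<open>f v \<le> f u \<le> f x\<close>, so \<open>f\<close> takes the
      value \<open>f u\<close> again on \<open>{x..v}\<close>; since \<open>u < x \<le> q\<close>,
      the two points are distinct.\<close>
    have "continuous_on {x..v} f"
      by (rule continuous_on_subset[OF cont]) (use x v in auto)
    then obtain q where "x \<le> q" "q \<le> v" "f q = f u"
      using IVT2'[of f v "f u" x] True le v by auto
    then show thesis using that[of u q] u v by auto
  next
    case False
    have "continuous_on {u..x} f"
      by (rule continuous_on_subset[OF cont]) (use x u in auto)
    then obtain p where "u \<le> p" "p \<le> x" "f p = f v"
      using IVT'[of f u "f v" x] False le u by auto
    then show thesis using that[of p v] u v by auto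
  qed
qed

text \<open>The pair \<open>a\<close>, \<open>b\<close> itself would not do: it forces
  \<open>c = a + \<beta>\<close>, which \<open>sym_diff_dom\<close> excludes. If an extremum is
  interior, the previous lemma applies to \<open>f\<close> or to \<open>- f\<close>.\<close>

lemma equal_values_in_interior:
  fixes f :: "real \<Rightarrow> real"
  assumes ab: "a < b" and cont: "continuous_on {a..b} f" and eq: "f a = f b"
  obtains p q where "a < p" "p < q" "q < b" "f p = f q"
proof -
  have ne: "{a..b} \<noteq> {}" using ab by simp
  obtain x where x: "x \<in> {a..b}" "\<And>y. y \<in> {a..b} \<Longrightarrow> f y \<le> f x"
    using continuous_attains_sup[OF compact_Icc ne cont] by blast
  obtain z where z: "z \<in> {a..b}" "\<And>y. y \<in> {a..b} \<Longrightarrow> f z \<le> f y"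
    using continuous_attains_inf[OF compact_Icc ne cont] by blast
  consider "a < x" "x < b" | "a < z" "z < b" | "x \<in> {a, b}" "z \<in> {a, b}"
    using x(1) z(1) by fastforce
  then show thesis
  proof cases
    case 1
    then show thesis using interior_max_imp_equal_values[OF cont _ _ x(2)] that by blast
  next
    case 2
    have "continuous_on {a..b} (\<lambda>t. - f t)" using cont by (intro continuous_intros)
    then obtain p q where "a < p" "p < q" "q < b" "- f p = - f q"
      using interior_max_imp_equal_values[of a b "\<lambda>t. - f t" z] 2 z(2) by auto
    then show thesis using that by simp
  next
    case 3
    \<comment> \<open>Maximum and minimum both lie at endpoints, where \<open>f\<close> has one
      common value, so they coincide.\<close>
    have const: "f y = f a" if "y \<in> {a..b}" for y
      using x(2)[OF that] z(2)[OF that] 3 eq by auto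
    obtain p where p: "a < p" "p < b" using dense ab by blast
    obtain q where q: "p < q" "q < b" using dense p by blast
    show thesis using that[of p q] p q const[of p] const[of q] by simp
  qed
qed

theorem theorem5p3p13:
  fixes f :: "real \<Rightarrow> real" and a b :: real
  assumes "a < b"
    and "continuous_on {a..b} f"
    and "f a = f b"
  shows "\<exists>\<alpha> \<beta> c. 0 < \<alpha> \<and> 0 < \<beta> \<and> max \<alpha> \<beta> < b - a \<and> c \<in> {a<..<b} \<and>
           c \<in> sym_diff_dom a b \<alpha> \<beta> \<and> sym_diff_deriv \<alpha> \<beta> f c = 0"
proof -
  obtain p q where pq: "a < p" "p < q" "q < b" "f p = f q"
    using equal_values_in_interior[OF assms] .
  define h c where "h = (q - p) / 2" and "c = (p + q) / 2"
  have ends: "c - h = p" "c + h = q" unfolding h_def c_def by (simp_all add: field_simps)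
  have "0 < h" using pq by (simp add: h_def)
  \<comment> \<open>With \<open>\<alpha> = \<beta> = h\<close>, membership amounts to
    \<open>a < c - h = p\<close> and \<open>q = c + h < b\<close>, both strict.\<close>
  moreover have "c \<in> sym_diff_dom a b h h"
    using pq ends \<open>0 < h\<close> unfolding sym_diff_dom_def by auto
  moreover have "sym_diff_deriv h h f c = 0"
    unfolding sym_diff_deriv_def ends using pq by simp
  moreover have "max h h < b - a" "c \<in> {a<..<b}" using pq ends \<open>0 < h\<close> by auto
  ultimately show ?thesis by blast
qed

end
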